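(* Let $m\in\mathbb{N}$, $m\geq2$, $n\in\mathbb{N}$ and $q\in\mathbb{C}\setminus\{0\}$ be such that $|q|\neq1$. Suppose that there exist nonconstant polynomials $f_1,\ldots,f_{m+1}\in\mathbb{C}[z]$ satisfying $$[f_1]_q^n+[f_2]_q^n+\cdots+[f_m]_q^n=[f_{m+1}]_q^n.$$ Suppose further that $[f_1]_q^n,\ldots,[f_{m+1}]_q^n$ are pairwise relatively $q$-prime and that $[f_1]_q^n,\ldots,[f_m]_q^n$ are linearly independent over $\mathbb{C}$. Then $$n\leq m^2-1-\frac{m(m-1)}{2\max_{1\leq i\leq m+1}\{\deg(f_i)\}}.$$
   Context: For a polynomial $P$, $[P]_q^n:=P(z)P(qz)\cdots P(q^{n-1}z)$. Separately, for $w\in\mathbb{C}$ the $q$-power of a linear factor is denoted $[z-w]_q^0=1$ and $[z-w]_q^k=(z-w)(z-wq)\cdots(z-wq^{k-1})$ for $k\ge 1$; this is the meaning of $[z-w]_q^k$ in the definition below. The $q$-derivative is $D_qf(z)=\frac{f(qz)-f(z)}{qz-z}$ for $z\neq 0$, and $D_qf(0)=f'(0)$; $D_q^0f=f$, $D_q^kf=D_q^{k-1}(D_qf)$. A point $z_0$ is a zero of $f$ with $q$-weight $k$ if $D_q^jf(z_0)=0$ for all $0\le j<k$, but $D_q^kf(z_0)\neq0$ (infinite $q$-weight if $D_q^jf(z_0)=0$ for all $j\ge0$). Common $q$-divisor: for entire $f,g$, the linear factor $z-z_0$ is a common $q$-divisor of $f$ and $g$ if there are a zero $z_1$ of $f$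 with $q$-weight $k\geq 1$, a zero $z_2$ of $g$ with $q$-weight $l\geq 1$ ($q$-weights possibly infinite), integers $1\le k_1\le k$, $1\le l_1\le l$, and entire functions $F,G$ with $f(z)=[z-z_1]_q^{k_1}F(z)$, $g(z)=[z-z_2]_q^{l_1}G(z)$, such that $z_0\in\{z_1,z_2\}$ and $f(z)g(z)=[z-z_0]_q^{k_1+l_1}F(z)G(z)$. (If $z_0=z_1$ this means $z_2=q^{k_1}z_1$; if $z_0=z_2$ it means $z_1=q^{l_1}z_2$.) Two functions are relatively $q$-prime if they have no nonconstant common $q$-divisor. *)

theory Defs
  imports "HOL-Analysis.Analysis" "HOL-Computational_Algebra.Polynomial"
begin

text \<open>\<open>[P]\<^sub>q\<^sup>n = P(z) P(qz) \<dots> P(q\<^sup>n\<^sup>-\<^sup>1z)\<close>, as a function of \<open>z\<close>.\<close>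

definition q_shift_prod :: "complex \<Rightarrow> nat \<Rightarrow> complex poly \<Rightarrow> complex \<Rightarrow> complex" where
  "q_shift_prod q n P z = (\<Prod>k<n. poly P (q ^ k * z))"

text \<open>The \<open>q\<close>-power \<open>[z - w]\<^sub>q\<^sup>k\<close> of a linear factor. It shifts the root \<open>w\<close> and not the
  argument \<open>z\<close>, so it is not an instance of \<^const>\<open>q_shift_prod\<close>.\<close>

definition q_linear_power :: "complex \<Rightarrow> complex \<Rightarrow> nat \<Rightarrow> complex \<Rightarrow> complex" where
  "q_linear_power q w k z = (\<Prod>j<k. (z - w * q ^ j))"

definition q_deriv :: "complex \<Rightarrow> (complex \<Rightarrow> complex) \<Rightarrow> complex \<Rightarrow> complex" where
  "q_deriv q f z = (if z = 0 then deriv f 0 else (f (q * z) - f z) / (q * z - z))"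

text \<open>\<open>f\<close> has \<open>q\<close>-weight \<open>k\<close> at \<open>z0\<close>; \<open>k = \<infinity>\<close> means that all iterated
  \<open>q\<close>-derivatives vanish at \<open>z0\<close>. The point \<open>z0\<close> is an actual zero of \<open>f\<close> iff \<open>k \<ge> 1\<close>.\<close>

definition has_q_weight ::
    "complex \<Rightarrow> (complex \<Rightarrow> complex) \<Rightarrow> complex \<Rightarrow> enat \<Rightarrow> bool" where
  "has_q_weight q f z0 k \<longleftrightarrow>
     (\<forall>j. enat j < k \<longrightarrow> (q_deriv q ^^ j) f z0 = 0) \<and>
     (\<forall>j. k = enat j \<longrightarrow> (q_deriv q ^^ j) f z0 \<noteq> 0)"

text \<open>The linear factor \<open>z - z0\<close> is a common \<open>q\<close>-divisor of \<open>f\<close> and \<open>g\<close>. The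
  factorizations force \<open>f\<close> and \<open>g\<close> to be entire, so this is not demanded separately.\<close>

definition common_q_divisor ::
    "complex \<Rightarrow> (complex \<Rightarrow> complex) \<Rightarrow> (complex \<Rightarrow> complex) \<Rightarrow> complex \<Rightarrow> bool" where
  "common_q_divisor q f g z0 \<longleftrightarrow>
     (\<exists>z1 z2 (k :: enat) (l :: enat) (k1 :: nat) (l1 :: nat) F G.
        k \<ge> 1 \<and> has_q_weight q f z1 k \<and>
        l \<ge> 1 \<and> has_q_weight q g z2 l \<and>
        1 \<le> k1 \<and> enat k1 \<le> k \<and> 1 \<le> l1 \<and> enat l1 \<le> l \<and>
        F holomorphic_on UNIV \<and> G holomorphic_on UNIV \<and>
        (\<forall>z. f z = q_linear_power q z1 k1 z * F z) \<and>
        (\<forall>z. g z = q_linear_power q z2 l1 z * G z) \<and>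
        z0 \<in> {z1, z2} \<and>
        (\<forall>z. f z * g z = q_linear_power q z0 (k1 + l1) z * F z * G z))"

text \<open>Common \<open>q\<close>-divisors are linear factors, so they are automatically nonconstant.\<close>

definition relatively_q_prime ::
    "complex \<Rightarrow> (complex \<Rightarrow> complex) \<Rightarrow> (complex \<Rightarrow> complex) \<Rightarrow> bool" where
  "relatively_q_prime q f g \<longleftrightarrow> \<not> (\<exists>z0. common_q_divisor q f g z0)"

end

theory Submission
  imports Defs "Jordan_Normal_Form.Determinant"
    "HOL-Computational_Algebra.Fundamental_Theorem_Algebra"
    "HOL-Computational_Algebra.Field_as_Ring"
begin

text \<open>
  This is the Wronskian proof of the generalized Mason theorem, with \<open>q\<close>-differences in place of
  derivatives. Let \<open>F\<^sub>j = [f\<^sub>j]\<^sub>q\<^sup>n\<close>, of degree \<open>n d\<^sub>j\<close>, let \<open>S\<close> be the sum of the \<open>m + 1\<close> degrees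
  \<open>d\<^sub>j\<close> and \<open>D\<close> their maximum, and let \<open>W\<close> be the determinant of the \<open>q\<close>-differences of order
  \<open>0, \<dots>, m - 1\<close> of \<open>F\<^sub>1, \<dots>, F\<^sub>m\<close>. The proof compares the degree of \<open>W\<close> with that of a divisor.

  \<^item> \<open>W\<close> is nonzero, because \<open>F\<^sub>1, \<dots>, F\<^sub>m\<close> are linearly independent and \<open>q\<close> is not a root of unity
    (\<open>q_wronskian_nonzero\<close>).

  \<^item> A \<open>q\<close>-difference of order less than \<open>m\<close> of \<open>F\<^sub>j\<close> combines \<open>F\<^sub>j(z), \<dots>, F\<^sub>j(q\<^sup>m\<^sup>-\<^sup>1z)\<close>. These
    products overlap: all contain \<open>G\<^sub>j(z) = f\<^sub>j(q\<^sup>m\<^sup>-\<^sup>1z) \<dots> f\<^sub>j(q\<^sup>n\<^sup>-\<^sup>1z)\<close>, of degree \<open>(n - m + 1) d\<^sub>j\<close>.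
    This replaces the high multiplicity of the zeros of an \<open>n\<close>-th power. Moreover the difference of
    order \<open>i\<close> gains a factor \<open>z\<^sup>i\<close>, even on top of the zeros of \<open>G\<^sub>j\<close> at the origin
    (\<open>monom_mult_q_block_dvd_qdiff\<close>). The factors \<open>z\<^sup>i\<close> add up to the exponent \<open>m (m - 1) / 2\<close> in the
    bound.

  \<^item> Since the \<open>F\<^sub>j\<close> with \<open>j \<le> m\<close> add up to \<open>F\<^sub>m\<^sub>+\<^sub>1\<close>, any column may be exchanged for that of
    \<open>F\<^sub>m\<^sub>+\<^sub>1\<close>. Hence \<open>W\<close> is divisible by \<open>z\<close> to the power \<open>m (m - 1) / 2\<close> times the product of all
    \<open>m + 1\<close> factors \<open>G\<^sub>j\<close>, while its degree is at most the sum of the degrees of any \<open>m\<close> of the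
    \<open>F\<^sub>j\<close>, so at most \<open>n (S - D)\<close> (\<open>degree_balance\<close>). This uses that two \<open>G\<^sub>j\<close> have no common zero,
    which is what relative \<open>q\<close>-primality gives once \<open>n \<ge> 2\<close> (\<open>relatively_q_prime_no_common_zero\<close>).

  Together, \<open>m (m - 1) / 2 + (n - m + 1) S \<le> n (S - D)\<close>, that is
  \<open>n D \<le> (m - 1) S - m (m - 1) / 2\<close>, and \<open>S \<le> (m + 1) D\<close> gives the bound. The argument is for
  \<open>n > m\<close>; for \<open>n \<le> m\<close> the bound is immediate.
\<close>

(* frees the name for scalar multiplication of polynomials *)
hide_const (open) Module.smult

section \<open>Dilations of polynomials\<close>

definition dilate :: "'a::comm_ring_1 \<Rightarrow> 'a poly \<Rightarrow> 'a poly" where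
  "dilate c p = pcompose p [:0, c:]"

lemma poly_dilate [simp]: "poly (dilate c p) x = poly p (c * x)"
  by (simp add: dilate_def poly_pcompose mult.commute)

lemma coeff_dilate [simp]: "coeff (dilate c p) d = c ^ d * coeff p d"
  by (simp add: dilate_def coeff_pcompose_linear)

lemma dilate_dilate: "dilate a (dilate b p) = dilate (a * b) p"
  by (simp add: poly_eq_iff power_mult_distrib mult_ac)

lemma dilate_one [simp]: "dilate 1 p = p"
  by (simp add: poly_eq_iff)

lemma dilate_zero [simp]: "dilate c 0 = 0"
  by (simp add: dilate_def)

lemma dilate_diff: "dilate c (p - r) = dilate c p - dilate c r"
  by (simp add: dilate_def pcompose_diff)

lemma dilate_mult: "dilate c (p * r) = dilate c p * dilate c r"
  by (simp add: dilate_def pcompose_mult)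

lemma dilate_sum: "dilate c (\<Sum>x\<in>A. p x) = (\<Sum>x\<in>A. dilate c (p x))"
  by (simp add: dilate_def pcompose_sum)

lemma dilate_prod: "dilate c (\<Prod>x\<in>A. p x) = (\<Prod>x\<in>A. dilate c (p x))"
  by (simp add: dilate_def pcompose_prod)

lemma dilate_smult: "dilate c (smult a p) = smult a (dilate c p)"
  by (simp add: dilate_def pcompose_smult)

lemma dilate_monom: "dilate c (monom a e) = monom (c ^ e * a) e"
  by (simp add: poly_eq_iff)

lemma degree_dilate [simp]:
  fixes c :: "'a::field"
  assumes "c \<noteq> 0"
  shows "degree (dilate c p) = degree p"
  using assms by (simp add: dilate_def degree_pcompose)

lemma dilate_eq_0_iff [simp]:
  fixes c :: "'a::field"
  assumes "c \<noteq> 0"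
  shows "dilate c p = 0 \<longleftrightarrow> p = 0"
  using assms by (simp add: poly_eq_iff)

text \<open>The hypothesis says that \<open>a / b\<close> is a \<open>q\<close>-invariant rational function. Comparing leading
  coefficients, it forces \<open>q ^ degree a = q ^ degree b\<close>; so a nonzero solution \<open>a\<close> has the degree
  of \<open>b\<close>. Subtracting the multiple of \<open>b\<close> that lowers the degree leaves a solution of smaller
  degree, which is therefore zero.\<close>

lemma q_invariant_quotient_const:
  fixes a b :: "'a::field poly"
  assumes q: "q \<noteq> 0" "inj (\<lambda>k::nat. q ^ k)"
    and b: "b \<noteq> 0"
    and inv: "dilate q a * b = a * dilate q b"
  shows "\<exists>c. a = smult c b"
proof -
  have deg: "degree r = degree b" if "dilate q r * b = r * dilate q b" "r \<noteq> 0" for r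
  proof -
    have "coeff (dilate q r * b) (degree r + degree b)
        = coeff (r * dilate q b) (degree r + degree b)"
      using that(1) by simp
    moreover have "coeff (dilate q r * b) (degree r + degree b)
        = q ^ degree r * lead_coeff r * lead_coeff b"
      using coeff_mult_degree_sum[of "dilate q r" b] q by simp
    moreover have "coeff (r * dilate q b) (degree r + degree b)
        = lead_coeff r * (q ^ degree b * lead_coeff b)"
      using coeff_mult_degree_sum[of r "dilate q b"] q by simp
    ultimately have "q ^ degree r = q ^ degree b"
      using b that(2) by simp
    then show ?thesis
      using q(2) by (simp add: inj_eq)
  qed
  define c where "c = coeff a (degree b) / lead_coeff b"
  define r where "r = a - smult c b"
  have "dilate q r * b = r * dilate q b"
    by (simp add: r_def dilate_diff dilate_smult left_diff_distrib right_diff_distrib inv)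
      (simp add: mult.commute)
  moreover have "coeff r (degree b) = 0"
    using b by (simp add: r_def c_def)
  ultimately have "r = 0"
    using deg[of r] by (metis leading_coeff_0_iff)
  then show ?thesis
    by (auto simp: r_def)
qed

lemma smult_sum_right: "smult a (\<Sum>x\<in>A. p x) = (\<Sum>x\<in>A. smult a (p x))"
  by (simp add: poly_eq_iff coeff_sum sum_distrib_left)

section \<open>The q-difference operators\<close>

text \<open>With \<open>E p = p(q z)\<close>, this is \<open>(E - 1) (E - q) \<dots> (E - q ^ (i - 1))\<close>. For \<open>q\<close> other than \<open>0\<close> and
  \<open>1\<close> it is, up to a nonzero constant, \<open>z ^ i\<close> times the \<open>i\<close>-th iterated \<open>q\<close>-derivative.\<close>

primrec qdiff :: "'a::comm_ring_1 \<Rightarrow> nat \<Rightarrow> 'a poly \<Rightarrow> 'a poly" where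
  "qdiff q 0 p = p"
| "qdiff q (Suc i) p = dilate q (qdiff q i p) - smult (q ^ i) (qdiff q i p)"

lemma coeff_qdiff: "coeff (qdiff q i p) d = (\<Prod>k<i. q ^ d - q ^ k) * coeff p d"
  by (induction i) (simp_all add: algebra_simps)

lemma qdiff_dilate: "qdiff q i (dilate c p) = dilate c (qdiff q i p)"
  by (simp add: poly_eq_iff coeff_qdiff mult_ac)

lemma qdiff_add: "qdiff q i (p + r) = qdiff q i p + qdiff q i r"
  by (simp add: poly_eq_iff coeff_qdiff algebra_simps)

lemma degree_qdiff_le: "degree (qdiff q i p) \<le> degree p"
  by (rule degree_le) (simp add: coeff_qdiff coeff_eq_0)

text \<open>The operator of index \<open>i\<close> is a combination, with constant coefficients, of the dilations by
  \<open>1, q, \<dots>, q ^ i\<close>.\<close>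

lemma dvd_qdiff:
  assumes "\<And>k. k \<le> i \<Longrightarrow> g dvd dilate (q ^ k) p"
  shows "g dvd qdiff q i p"
  using assms
proof (induction i arbitrary: p)
  case 0
  then show ?case by (metis dilate_one le_refl power_0 qdiff.simps(1))
next
  case (Suc i)
  have "g dvd qdiff q i (dilate q p)"
  proof (rule Suc.IH)
    fix k assume "k \<le> i"
    then show "g dvd dilate (q ^ k) (dilate q p)"
      using Suc.prems[of "Suc k"] by (simp add: dilate_dilate mult.commute)
  qed
  moreover have "g dvd qdiff q i p"
    by (rule Suc.IH) (use Suc.prems in auto)
  ultimately show ?case
    by (simp add: qdiff_dilate dvd_smult)
qed

text \<open>Conversely the dilations are combinations of the operators \<open>qdiff q i\<close>: multiply
  \<open>E (qdiff q i) = qdiff q (i + 1) + q ^ i qdiff q i\<close> by powers of \<open>E\<close>.\<close>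

lemma sum_dilate_eq_0_if_sum_qdiff_eq_0:
  assumes zero: "\<And>i. i < m \<Longrightarrow> (\<Sum>j\<in>J. c j * qdiff q i (F j)) = 0"
    and "k + i < m"
  shows "(\<Sum>j\<in>J. c j * dilate (q ^ k) (qdiff q i (F j))) = 0"
  using assms(2)
proof (induction k arbitrary: i)
  case 0
  then show ?case by (simp add: zero)
next
  case (Suc k)
  have "dilate (q ^ Suc k) (qdiff q i (F j))
      = dilate (q ^ k) (qdiff q (Suc i) (F j)) + smult (q ^ i) (dilate (q ^ k) (qdiff q i (F j)))"
    for j
    by (simp add: dilate_diff dilate_smult dilate_dilate mult.commute)
  then have "(\<Sum>j\<in>J. c j * dilate (q ^ Suc k) (qdiff q i (F j)))
      = (\<Sum>j\<in>J. c j * dilate (q ^ k) (qdiff q (Suc i) (F j)))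
        + smult (q ^ i) (\<Sum>j\<in>J. c j * dilate (q ^ k) (qdiff q i (F j)))"
    by (simp only: distrib_left sum.distrib smult_sum_right mult_smult_right)
  also have "\<dots> = 0"
    using Suc.IH[of "Suc i"] Suc.IH[of i] Suc.prems by simp
  finally show ?case .
qed

text \<open>This is the classical argument for the Casoratian. Take a nontrivial polynomial relation
  between the columns and suppose that its last coefficient \<open>c m\<close> is nonzero. Cross-multiplying
  the relation with its dilation by \<open>q\<close> eliminates the last column, so by induction every quotient
  \<open>c j / c m\<close> is \<open>q\<close>-invariant, hence constant: the relation is one over the field. The shift
  \<open>s\<close> is there because the elimination consumes the row \<open>i = 0\<close>.\<close>

lemma dilates_independent:
  fixes F c :: "nat \<Rightarrow> 'a::field poly"
  assumes q: "q \<noteq> 0" "inj (\<lambda>k::nat. q ^ k)"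
    and indep: "\<And>a. (\<Sum>j<m. smult (a j) (F j)) = 0 \<Longrightarrow> (\<And>j. j < m \<Longrightarrow> a j = 0)"
    and rel: "\<And>i. i < m \<Longrightarrow> (\<Sum>j<m. c j * dilate (q ^ (i + s)) (F j)) = 0"
    and "j < m"
  shows "c j = 0"
  using indep rel \<open>j < m\<close>
proof (induction m arbitrary: c s j)
  case 0
  then show ?case by simp
next
  case (Suc m)
  have indep': "a j = 0" if "(\<Sum>j<m. smult (a j) (F j)) = 0" "j < m" for a j
    using Suc.prems(1)[of "a(m := 0)" j] that by simp
  have cm: "c m = 0"
  proof (rule ccontr)
    assume nz: "c m \<noteq> 0"
    define d where "d j = dilate q (c j) * c m - c j * dilate q (c m)" for j
    have "d j = 0" if "j < m" for j
    proof (rule Suc.IH[where s = "Suc s"])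
      fix i assume i: "i < m"
      have "dilate q (\<Sum>j<Suc m. c j * dilate (q ^ (i + s)) (F j)) = 0"
        using Suc.prems(2)[of i] i by simp
      then have 1: "(\<Sum>j<Suc m. dilate q (c j) * dilate (q ^ (i + Suc s)) (F j)) = 0"
        by (simp only: dilate_sum dilate_mult dilate_dilate power_Suc add_Suc_right)
      have 2: "(\<Sum>j<Suc m. c j * dilate (q ^ (i + Suc s)) (F j)) = 0"
        using Suc.prems(2)[of "Suc i"] i by simp
      have "(\<Sum>j<Suc m. d j * dilate (q ^ (i + Suc s)) (F j))
          = c m * (\<Sum>j<Suc m. dilate q (c j) * dilate (q ^ (i + Suc s)) (F j))
            - dilate q (c m) * (\<Sum>j<Suc m. c j * dilate (q ^ (i + Suc s)) (F j))"
        unfolding sum_distrib_left sum_subtractf[symmetric]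
        by (rule sum.cong) (simp_all add: d_def algebra_simps)
      also have "\<dots> = 0"
        by (simp only: 1 2 mult_zero_right diff_zero)
      finally show "(\<Sum>j<m. d j * dilate (q ^ (i + Suc s)) (F j)) = 0"
        by (simp add: d_def)
    qed (use indep' that in auto)
    then have "\<exists>a. c j = smult a (c m)" if "j < m" for j
      using that nz by (intro q_invariant_quotient_const[OF q]) (auto simp: d_def)
    moreover have "c m = smult 1 (c m)"
      by simp
    ultimately have "\<forall>j<Suc m. \<exists>a. c j = smult a (c m)"
      using less_Suc_eq by metis
    then obtain a where a: "\<And>j. j < Suc m \<Longrightarrow> c j = smult (a j) (c m)"
      by metis
    have "0 = (\<Sum>j<Suc m. c j * dilate (q ^ s) (F j))"
      using Suc.prems(2)[of 0] by simp
    also have "\<dots> = (\<Sum>j<Suc m. c m * dilate (q ^ s) (smult (a j) (F j)))"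
    proof (rule sum.cong)
      fix j assume "j \<in> {..<Suc m}"
      then have "c j = smult (a j) (c m)"
        by (auto intro: a)
      then show "c j * dilate (q ^ s) (F j) = c m * dilate (q ^ s) (smult (a j) (F j))"
        by (metis dilate_smult mult_smult_left mult_smult_right)
    qed simp
    also have "\<dots> = c m * dilate (q ^ s) (\<Sum>j<Suc m. smult (a j) (F j))"
      by (simp only: dilate_sum sum_distrib_left)
    finally have "(\<Sum>j<Suc m. smult (a j) (F j)) = 0"
      using nz q by simp
    then have "a m = 0"
      by (rule Suc.prems(1)) simp
    then show False
      using a[of m] nz by (metis lessI smult_0_left)
  qed
  show ?case
  proof (cases "j = m")
    case False
    then have "j < m" using Suc.prems(3) by simp
    then show ?thesis
    proof (rule Suc.IH[where s = s, rotated 2])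
      fix i assume "i < m"
      then show "(\<Sum>j<m. c j * dilate (q ^ (i + s)) (F j)) = 0"
        using Suc.prems(2)[of i] cm by simp
    qed (use indep' in auto)
  qed (use cm in simp)
qed

section \<open>The q-Wronskian\<close>

definition q_wronskian :: "'a::comm_ring_1 \<Rightarrow> nat \<Rightarrow> (nat \<Rightarrow> 'a poly) \<Rightarrow> 'a poly" where
  "q_wronskian q m F = Determinant.det (Matrix.mat m m (\<lambda>(i, j). qdiff q i (F j)))"

lemma q_wronskian_expand:
  "q_wronskian q m F
    = (\<Sum>p | p permutes {..<m}. of_int (sign p) * (\<Prod>i<m. qdiff q i (F (p i))))"
  unfolding q_wronskian_def
  by (subst det_def'[of _ m])
     (auto simp: lessThan_atLeast0 permutes_in_image intro!: sum.cong prod.cong)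

lemma q_wronskian_nonzero:
  fixes F :: "nat \<Rightarrow> 'a::field poly"
  assumes q: "q \<noteq> 0" "inj (\<lambda>k::nat. q ^ k)"
    and indep: "\<And>a j. (\<Sum>j<m. smult (a j) (F j)) = 0 \<Longrightarrow> j < m \<Longrightarrow> a j = 0"
  shows "q_wronskian q m F \<noteq> 0"
proof
  let ?A = "Matrix.mat m m (\<lambda>(i, j). qdiff q i (F j))"
  assume "q_wronskian q m F = 0"
  then obtain v where v: "v \<in> carrier_vec m" "v \<noteq> 0\<^sub>v m" "?A *\<^sub>v v = 0\<^sub>v m"
    unfolding q_wronskian_def by (subst (asm) det_0_iff_vec_prod_zero[of _ m]) auto
  define c where "c j = vec_index v j" for j
  have "(\<Sum>j<m. c j * qdiff q i (F j)) = 0" if "i < m" for i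
  proof -
    have "0 = vec_index (?A *\<^sub>v v) i"
      using v that by simp
    also have "\<dots> = (\<Sum>j<m. c j * qdiff q i (F j))"
      using v(1) that
      by (simp add: scalar_prod_def c_def lessThan_atLeast0 mult.commute cong: sum.cong_simp)
    finally show ?thesis by simp
  qed
  from sum_dilate_eq_0_if_sum_qdiff_eq_0[OF this, of m _ 0]
  have rel: "(\<Sum>j<m. c j * dilate (q ^ (i + 0)) (F j)) = 0" if "i < m" for i
    using that by simp
  have "c j = 0" if "j < m" for j
  proof (rule dilates_independent[OF q])
    show "a k = 0" if "(\<Sum>j<m. smult (a j) (F j)) = 0" "k < m" for a k
      using that by (rule indep)
  qed (fact rel that)+
  then have "v = 0\<^sub>v m"
    using v(1) by (auto simp: c_def)
  with v(2) show False by simp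
qed

lemma q_wronskian_dvd:
  assumes "\<And>i j. i < m \<Longrightarrow> j < m \<Longrightarrow> monom 1 i * G j dvd qdiff q i (F j)"
  shows "monom 1 (\<Sum>i<m. i) * (\<Prod>j<m. G j) dvd q_wronskian q m F"
  unfolding q_wronskian_expand
proof (intro dvd_sum dvd_mult)
  fix p assume "p \<in> {p. p permutes {..<m}}"
  then have p: "p permutes {..<m}" by simp
  have monom_sum: "monom 1 (\<Sum>i<k. i) = (\<Prod>i<k. monom (1::'a) i)" for k
  proof (induction k)
    case (Suc k)
    then show ?case
      using mult_monom[of "1::'a" "\<Sum>i<k. i" 1 k] by simp
  qed simp
  have "monom 1 (\<Sum>i<m. i) * (\<Prod>j<m. G j) = (\<Prod>i<m. monom 1 i * G (p i))"
    using prod.permute[OF p, of G] by (simp add: prod.distrib monom_sum comp_def)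
  also have "\<dots> dvd (\<Prod>i<m. qdiff q i (F (p i)))"
    using assms permutes_in_image[OF p] by (intro prod_dvd_prod) auto
  finally show "monom 1 (\<Sum>i<m. i) * (\<Prod>j<m. G j) dvd (\<Prod>i<m. qdiff q i (F (p i)))" .
qed

lemma degree_q_wronskian_le:
  fixes F :: "nat \<Rightarrow> 'a::field poly"
  shows "degree (q_wronskian q m F) \<le> (\<Sum>j<m. degree (F j))"
  unfolding q_wronskian_expand
proof (rule degree_sum_le)
  show "finite {p. p permutes {..<m}}"
    by (simp add: finite_permutations)
  fix p assume "p \<in> {p. p permutes {..<m}}"
  then have p: "p permutes {..<m}" by simp
  have "degree (of_int (sign p) * (\<Prod>i<m. qdiff q i (F (p i))))
      \<le> degree (\<Prod>i<m. qdiff q i (F (p i)))"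
    by (simp add: sign_def)
  also have "\<dots> \<le> (\<Sum>i<m. degree (qdiff q i (F (p i))))"
    using degree_prod_sum_le[of "{..<m}" "\<lambda>i. qdiff q i (F (p i))"] by (simp add: comp_def)
  also have "\<dots> \<le> (\<Sum>i<m. degree (F (p i)))"
    by (intro sum_mono degree_qdiff_le)
  also have "\<dots> = (\<Sum>j<m. degree (F j))"
    using sum.permute[OF p, of "\<lambda>j. degree (F j)"] by (simp add: comp_def)
  finally show "degree (of_int (sign p) * (\<Prod>i<m. qdiff q i (F (p i))))
      \<le> (\<Sum>j<m. degree (F j))" .
qed

lemma q_wronskian_add_columns:
  assumes "finite S" "S \<subseteq> {..<m} - {t}"
  shows "q_wronskian q m (F(t := F t + sum F S)) = q_wronskian q m F"
  using assms
proof (induction S)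
  case empty
  then show ?case by simp
next
  case (insert x S)
  let ?M = "\<lambda>H. Matrix.mat m m (\<lambda>(i, j). qdiff q i (H j))"
  have "?M (F(t := F t + sum F (insert x S))) = addcol 1 t x (?M (F(t := F t + sum F S)))"
    by (rule eq_matI) (use insert in \<open>auto simp: qdiff_add add_ac\<close>)
  moreover have "Determinant.det (addcol 1 t x (?M (F(t := F t + sum F S))))
      = Determinant.det (?M (F(t := F t + sum F S)))"
    by (rule det_addcol[where n = m]) (use insert in auto)
  ultimately show ?case
    using insert by (simp add: q_wronskian_def)
qed

corollary q_wronskian_replace_column:
  assumes "t < m"
  shows "q_wronskian q m (F(t := \<Sum>j<m. F j)) = q_wronskian q m F"
  using q_wronskian_add_columns[of "{..<m} - {t}" m t q F] assms
  by (simp add: sum.remove[of "{..<m}" t F])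

section \<open>Divisors of the q-Wronskian against its degree\<close>

lemma coprime_if_no_common_root:
  fixes p r :: "complex poly"
  assumes "\<And>x. poly p x = 0 \<Longrightarrow> poly r x \<noteq> 0"
  shows "coprime p r"
proof (rule coprimeI)
  fix c assume c: "c dvd p" "c dvd r"
  have "poly c x \<noteq> 0" for x
    using c assms[of x] by (auto elim!: dvdE)
  then have "constant (poly c)" "c \<noteq> 0"
    using fundamental_theorem_of_algebra by (blast, force)
  then show "c dvd 1"
    by (simp add: is_unit_iff_degree constant_degree)
qed

text \<open>The \<open>q\<close>-Wronskian \<open>W\<close> of the first \<open>m\<close> columns does not change when a column \<open>t\<close> is replaced by
  the sum \<open>F m\<close>. Hence, next to its power of \<open>z\<close>, \<open>W\<close> is divisible both by the product of the
  \<open>G j\<close> with \<open>j \<noteq> m\<close> and by the product of those with \<open>j \<noteq> t\<close>. As \<open>G t\<close> and \<open>G m\<close> are coprime, it is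
  divisible by the product of all of them. On the other side the degree of \<open>W\<close> is at most the sum of the degrees of any
  \<open>m\<close> of the columns, in particular of all but the one of largest degree.\<close>

lemma degree_balance:
  fixes F G :: "nat \<Rightarrow> complex poly"
  assumes q: "q \<noteq> 0" "inj (\<lambda>k::nat. q ^ k)"
    and "m > 0"
    and sum: "(\<Sum>j<m. F j) = F m"
    and indep: "\<And>a j. (\<Sum>j<m. smult (a j) (F j)) = 0 \<Longrightarrow> j < m \<Longrightarrow> a j = 0"
    and dvd: "\<And>i j. i < m \<Longrightarrow> j \<le> m \<Longrightarrow> monom 1 i * G j dvd qdiff q i (F j)"
    and nz: "\<And>j. j \<le> m \<Longrightarrow> G j \<noteq> 0"
    and coprime: "\<And>j. j < m \<Longrightarrow> coprime (G j) (G m)"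
    and u: "u \<le> m"
  shows "(\<Sum>i<m. i) + (\<Sum>j\<le>m. degree (G j)) + degree (F u) \<le> (\<Sum>j\<le>m. degree (F j))"
proof -
  \<comment> \<open>the column exchanged with the last one; if the omitted column \<open>u\<close> is the last one itself, any
     will do\<close>
  define t where "t = (if u < m then u else 0)"
  have t: "t < m" using \<open>m > 0\<close> by (simp add: t_def)
  let ?W = "q_wronskian q m F"
  let ?F = "F(t := F m)" and ?G = "G(t := G m)"
  have W: "q_wronskian q m ?F = ?W"
    using q_wronskian_replace_column[OF t, of q F] sum by simp
  define P where "P = monom (1::complex) (\<Sum>i<m. i)"
  define A where "A = (\<Prod>j\<in>{..<m} - {t}. G j)"
  have "P * (\<Prod>j<m. G j) dvd ?W"
    unfolding P_def by (rule q_wronskian_dvd) (use dvd in auto)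
  then have "P * A * G t dvd ?W"
    using t by (simp add: A_def prod.remove[of "{..<m}" t] mult_ac)
  then obtain Q where Q: "?W = P * A * G t * Q"
    by (elim dvdE)
  have "P * (\<Prod>j<m. ?G j) dvd ?W"
    unfolding P_def W[symmetric] by (rule q_wronskian_dvd) (use dvd in auto)
  moreover have "(\<Prod>j<m. ?G j) = G m * A"
    using t by (simp add: A_def prod.remove[of "{..<m}" t])
  ultimately have "P * A * G m dvd ?W"
    by (simp add: mult_ac)
  then obtain R where R: "?W = P * A * G m * R"
    by (elim dvdE)
  have "P \<noteq> 0" "A \<noteq> 0"
    using nz by (auto simp: P_def A_def)
  then have "G t * Q = G m * R"
    using Q R by (simp add: mult.assoc)
  then have "G m dvd G t * Q"
    by simp
  then have "G m dvd Q"
    using coprime[OF t] by (simp add: coprime_dvd_mult_right_iff coprime_commute)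
  then obtain Q' where Q': "Q = G m * Q'"
    by (elim dvdE)
  have W0: "?W \<noteq> 0"
    by (rule q_wronskian_nonzero[OF q]) (use indep in auto)
  have sum_split: "(\<Sum>j\<le>m. h j) = h m + h t + (\<Sum>j\<in>{..<m} - {t}. h j)" for h :: "nat \<Rightarrow> nat"
    using t by (simp add: lessThan_Suc_atMost[symmetric] sum.remove[of "{..<m}" t])
  have "degree ?W = degree P + degree A + degree (G t) + degree (G m) + degree Q'"
    using W0 by (simp add: Q Q' degree_mult_eq)
  moreover have "degree P = (\<Sum>i<m. i)"
    by (simp add: P_def degree_monom_eq)
  moreover have "degree A = (\<Sum>j\<in>{..<m} - {t}. degree (G j))"
    unfolding A_def using nz by (intro degree_prod_eq_sum_degree) auto
  ultimately have lower: "(\<Sum>i<m. i) + (\<Sum>j\<le>m. degree (G j)) \<le> degree ?W"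
    using sum_split[of "\<lambda>j. degree (G j)"] by simp
  show ?thesis
  proof (cases "u < m")
    case True
    have "degree ?W \<le> (\<Sum>j<m. degree (?F j))"
      unfolding W[symmetric] by (rule degree_q_wronskian_le)
    also have "\<dots> = degree (F m) + (\<Sum>j\<in>{..<m} - {t}. degree (F j))"
      using t by (simp add: sum.remove[of "{..<m}" t])
    finally show ?thesis
      using lower sum_split[of "\<lambda>j. degree (F j)"] True by (simp add: t_def)
  next
    case False
    then have "u = m" using u by simp
    have "degree ?W \<le> (\<Sum>j<m. degree (F j))"
      by (rule degree_q_wronskian_le)
    then show ?thesis
      using lower \<open>u = m\<close> by (simp add: lessThan_Suc_atMost[symmetric])
  qed
qed

section \<open>Shift products\<close>

definition q_block :: "complex \<Rightarrow> nat set \<Rightarrow> complex poly \<Rightarrow> complex poly" where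
  "q_block q K p = (\<Prod>k\<in>K. dilate (q ^ k) p)"

lemma poly_q_block: "poly (q_block q {..<n} p) z = q_shift_prod q n p z"
  by (simp add: q_block_def q_shift_prod_def poly_prod)

lemma q_block_nonzero: "q \<noteq> 0 \<Longrightarrow> p \<noteq> 0 \<Longrightarrow> finite K \<Longrightarrow> q_block q K p \<noteq> 0"
  by (simp add: q_block_def)

lemma degree_q_block:
  assumes "q \<noteq> 0" "p \<noteq> 0"
  shows "degree (q_block q K p) = card K * degree p"
  using assms by (simp add: q_block_def degree_prod_eq_sum_degree)

lemma q_block_monom_mult:
  assumes "q \<noteq> 0" "finite K"
  shows "\<exists>c. c \<noteq> 0 \<and> q_block q K (monom 1 e * h) = monom c (e * card K) * q_block q K h"
  using assms(2)
proof induction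
  case empty
  show ?case by (intro exI[of _ 1]) (simp add: q_block_def)
next
  case (insert k K)
  then obtain c where "c \<noteq> 0" "q_block q K (monom 1 e * h) = monom c (e * card K) * q_block q K h"
    by blast
  moreover have "monom ((q ^ k) ^ e * c) (e * card (insert k K))
      = monom ((q ^ k) ^ e) e * monom c (e * card K)"
    using insert.hyps by (simp add: mult_monom)
  ultimately show ?case
    using insert.hyps \<open>q \<noteq> 0\<close>
    by (intro exI[of _ "(q ^ k) ^ e * c"]) (simp add: q_block_def dilate_mult dilate_monom)
qed

text \<open>The dilations of \<open>[p]\<close> by \<open>1, q, \<dots>, q ^ (m - 1)\<close> have the factors \<open>p(q ^ k z)\<close> with
  \<open>m - 1 \<le> k < n\<close> in common, so these survive in every \<open>q\<close>-difference; and \<open>qdiff q i\<close> kills all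
  powers of \<open>z\<close> below \<open>i\<close>. The two divisors interact if \<open>p\<close> has a zero of some order \<open>e > 0\<close> at the
  origin. Then the exponent \<open>i + e (n - m + 1)\<close> of \<open>z\<close> on the left is still at most the exponent
  \<open>e n\<close> of \<open>z\<close> in \<open>[p]\<close>, because \<open>i \<le> m - 1 \<le> e (m - 1)\<close>.\<close>

lemma monom_mult_q_block_dvd_qdiff:
  assumes q: "q \<noteq> 0" and p: "p \<noteq> 0" and i: "i < m" and mn: "m \<le> n"
  shows "monom 1 i * q_block q {m - 1..<n} p dvd qdiff q i (q_block q {..<n} p)"
proof -
  define e where "e = order 0 p"
  obtain h where h: "p = monom 1 e * h" "poly h 0 \<noteq> 0"
    using order_decomp[OF p, of 0]
    by (auto simp: e_def monom_altdef dvd_iff_poly_eq_0)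
  obtain c where c: "c \<noteq> 0"
    "q_block q {m - 1..<n} p = monom c (e * (n - (m - 1))) * q_block q {m - 1..<n} h"
    using q_block_monom_mult[OF q, of "{m - 1..<n}" e h] by (auto simp: h(1)[symmetric])
  obtain b where b: "q_block q {..<n} p = monom b (e * n) * q_block q {..<n} h"
    using q_block_monom_mult[OF q, of "{..<n}" e h] by (auto simp: h(1)[symmetric])
  define s where "s = i + e * (n - (m - 1))"
  have common: "q_block q {m - 1..<n} p dvd qdiff q i (q_block q {..<n} p)"
  proof (rule dvd_qdiff)
    fix k assume k: "k \<le> i"
    have "dilate (q ^ k) (q_block q {..<n} p) = (\<Prod>l<n. dilate (q ^ (k + l)) p)"
      by (simp add: q_block_def dilate_prod dilate_dilate power_add)
    also have "\<dots> = q_block q {k..<n + k} p"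
      unfolding q_block_def
      by (rule prod.reindex_bij_witness[of _ "\<lambda>l. l - k" "\<lambda>l. k + l"]) auto
    finally show "q_block q {m - 1..<n} p dvd dilate (q ^ k) (q_block q {..<n} p)"
      using k i by (auto simp: q_block_def intro!: prod_dvd_prod_subset)
  qed
  have "monom 1 s dvd qdiff q i (q_block q {..<n} p)"
  proof (unfold monom_1_dvd_iff', intro allI impI)
    fix d assume d: "d < s"
    show "coeff (qdiff q i (q_block q {..<n} p)) d = 0"
    proof (cases "d < i")
      case True
      then show ?thesis by (auto simp: coeff_qdiff intro!: prod_zero)
    next
      case False
      with d have "e > 0" by (cases e) (auto simp: s_def)
      then have "i \<le> e * (m - 1)"
        using i by (cases e) auto
      then have "s \<le> e * (m - 1) + e * (n - (m - 1))"
        by (simp add: s_def)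
      also have "\<dots> = e * n"
        using mn by (simp flip: distrib_left)
      finally show ?thesis
        using d by (simp add: coeff_qdiff b coeff_monom_mult)
    qed
  qed
  moreover have "q_block q {m - 1..<n} h dvd qdiff q i (q_block q {..<n} p)"
    using common c(2) by (metis dvd_mult_right)
  moreover have "coprime (monom 1 s) (q_block q {m - 1..<n} h)"
    by (rule coprime_if_no_common_root)
       (use h(2) in \<open>auto simp: poly_monom q_block_def poly_prod\<close>)
  ultimately have "monom 1 s * q_block q {m - 1..<n} h dvd qdiff q i (q_block q {..<n} p)"
    by (rule divides_mult)
  moreover have "monom 1 i * q_block q {m - 1..<n} p
      = smult c (monom 1 s * q_block q {m - 1..<n} h)"
    unfolding c(2) s_def mult.assoc[symmetric] mult_smult_left[symmetric]
    by (simp add: mult_monom smult_monom)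
  ultimately show ?thesis
    using c(1) by (simp add: smult_dvd)
qed

section \<open>Relatively q-prime shift products have no common zeros\<close>

lemma ex_q_weight_ge_1:
  assumes "f z = 0"
  shows "\<exists>k\<ge>1. has_q_weight q f z k"
proof (cases "\<exists>j. (q_deriv q ^^ j) f z \<noteq> 0")
  case True
  define k where "k = (LEAST j. (q_deriv q ^^ j) f z \<noteq> 0)"
  have "(q_deriv q ^^ k) f z \<noteq> 0"
    unfolding k_def using True by (rule LeastI_ex)
  moreover have "(q_deriv q ^^ j) f z = 0" if "j < k" for j
    using not_less_Least[OF that[unfolded k_def]] by simp
  moreover have "k \<noteq> 0"
    using calculation(1) assms by (intro notI) simp
  ultimately show ?thesis
    by (intro exI[of _ "enat k"]) (auto simp: has_q_weight_def one_enat_def)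
next
  case False
  then show ?thesis
    by (intro exI[of _ \<infinity>]) (auto simp: has_q_weight_def)
qed

text \<open>Since \<open>[z - a]\<^sub>q\<^sup>2 = (z - a) (z - q a)\<close>, a zero of one polynomial and the \<open>q\<close>-shifted zero of the
  other already combine to a common \<open>q\<close>-divisor, with exponents \<open>1\<close> and \<open>1\<close>.\<close>

lemma common_q_divisor_if_shifted_zero:
  assumes "poly p a = 0" "poly r (q * a) = 0"
  shows "common_q_divisor q (poly p) (poly r) a"
proof -
  obtain F where F: "p = [:- a, 1:] * F"
    using assms(1) by (metis dvdE poly_eq_0_iff_dvd)
  obtain G where G: "r = [:- (q * a), 1:] * G"
    using assms(2) by (metis dvdE poly_eq_0_iff_dvd)
  obtain k where k: "k \<ge> 1" "has_q_weight q (poly p) a k"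
    using ex_q_weight_ge_1[of "poly p" a q] assms by blast
  obtain l where l: "l \<ge> 1" "has_q_weight q (poly r) (q * a) l"
    using ex_q_weight_ge_1[of "poly r" "q * a" q] assms by blast
  show ?thesis
    unfolding common_q_divisor_def
  proof (intro exI conjI)
    show "k \<ge> 1" "has_q_weight q (poly p) a k" "l \<ge> 1" "has_q_weight q (poly r) (q * a) l"
      by fact+
    show "enat 1 \<le> k" "enat 1 \<le> l"
      using k l by (simp_all add: one_enat_def)
    show "poly F holomorphic_on UNIV" "poly G holomorphic_on UNIV"
      by (intro holomorphic_intros)+
    show "\<forall>z. poly p z = q_linear_power q a 1 z * poly F z"
      "\<forall>z. poly r z = q_linear_power q (q * a) 1 z * poly G z"
      by (simp_all add: F G q_linear_power_def algebra_simps)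
    show "\<forall>z. poly p z * poly r z = q_linear_power q a (1 + 1) z * poly F z * poly G z"
      by (simp add: F G q_linear_power_def algebra_simps)
  qed auto
qed

text \<open>The definition of a common \<open>q\<close>-divisor links a zero \<open>a\<close> to the zero \<open>q a\<close>, and on its own it
  does not exclude a common zero. For shift products of length at least \<open>2\<close> it does: the zeros of
  \<open>[p]\<close> come in runs \<open>w, w / q, \<dots>\<close>, so next to a zero \<open>a\<close> there is also \<open>q a\<close> or \<open>a / q\<close>.\<close>

lemma relatively_q_prime_no_common_zero:
  assumes q: "q \<noteq> 0" and n: "n \<ge> 2"
    and prime: "relatively_q_prime q (q_shift_prod q n p) (q_shift_prod q n r)"
      "relatively_q_prime q (q_shift_prod q n r) (q_shift_prod q n p)"
    and zero: "q_shift_prod q n p a = 0"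
  shows "q_shift_prod q n r a \<noteq> 0"
proof
  assume r: "q_shift_prod q n r a = 0"
  have poly: "q_shift_prod q n s = poly (q_block q {..<n} s)" for s
    by (simp add: poly_q_block fun_eq_iff)
  obtain k where k: "k < n" "poly p (q ^ k * a) = 0"
    using zero by (auto simp: q_shift_prod_def)
  show False
  proof (cases k)
    case (Suc t)
    then have "poly p (q ^ t * (q * a)) = 0" "t < n"
      using k by (simp_all add: mult_ac)
    then have "q_shift_prod q n p (q * a) = 0"
      by (auto simp: q_shift_prod_def)
    then show False
      using common_q_divisor_if_shifted_zero[of "q_block q {..<n} r" a "q_block q {..<n} p" q] r prime(2)
      by (auto simp: relatively_q_prime_def poly)
  next
    case 0
    then have "poly p (q ^ 1 * (a / q)) = 0"
      using k q by simp
    then have "q_shift_prod q n p (a / q) = 0"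
      using n by (auto simp: q_shift_prod_def intro!: bexI[of _ 1])
    then show False
      using common_q_divisor_if_shifted_zero[of "q_block q {..<n} p" "a / q" "q_block q {..<n} r" q]
        r prime(1) q
      by (auto simp: relatively_q_prime_def poly)
  qed
qed

section \<open>The bound\<close>

lemma inj_power_if_norm_neq_1:
  fixes q :: complex
  assumes "q \<noteq> 0" "norm q \<noteq> 1"
  shows "inj (\<lambda>k::nat. q ^ k)"
proof (rule injI)
  fix k l :: nat
  assume "q ^ k = q ^ l"
  then have "norm q ^ k = norm q ^ l"
    by (metis norm_power)
  then show "k = l"
    using assms power_inject_exp'[of "norm q" k l] by simp
qed

theorem theorem5p2:
  fixes m n :: nat and q :: complex and f :: "nat \<Rightarrow> complex poly"
  assumes m: "m \<ge> 2"
    and q: "q \<noteq> 0" "norm q \<noteq> 1"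
    and nonconst: "\<And>i. i \<in> {1..m+1} \<Longrightarrow> degree (f i) > 0"
    and eq: "\<And>z. (\<Sum>i=1..m. q_shift_prod q n (f i) z) = q_shift_prod q n (f (m+1)) z"
    and qprime: "pairwise (\<lambda>i j. relatively_q_prime q (q_shift_prod q n (f i))
                                    (q_shift_prod q n (f j))) {1..m+1}"
    and indep: "\<And>c :: nat \<Rightarrow> complex. (\<And>z. (\<Sum>i=1..m. c i * q_shift_prod q n (f i) z) = 0)
                  \<Longrightarrow> (\<And>i. i \<in> {1..m} \<Longrightarrow> c i = 0)"
  shows "real n \<le> (real m)\<^sup>2 - 1
           - real m * (real m - 1) / (2 * real (Max ((\<lambda>i. degree (f i)) ` {1..m+1})))"
proof -
  define D where "D = Max ((\<lambda>i. degree (f i)) ` {1..m+1})"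
  have D_ge: "degree (f i) \<le> D" if "i \<in> {1..m+1}" for i
    unfolding D_def using that by (intro Max_ge) auto
  have "D \<in> (\<lambda>i. degree (f i)) ` {1..m+1}"
    unfolding D_def by (rule Max_in) auto
  then obtain u' where u': "u' \<in> {1..m+1}" "degree (f u') = D"
    by auto
  then have "D \<ge> 1"
    using nonconst[of u'] by simp
  show ?thesis
  proof (cases "n \<le> m")
    case True
    \<comment> \<open>the right-hand side is at least \<open>m\<^sup>2 - 1 - m (m - 1) / 2\<close>, which is at least \<open>m\<close>\<close>
    have "real m * (real m - 1) / (2 * real D) \<le> real m * (real m - 1) / 2"
      using \<open>D \<ge> 1\<close> m by (intro divide_left_mono) auto
    moreover have "0 \<le> (real m - 2) * (real m + 1)"
      using m by simp
    then have "real m \<le> (real m)\<^sup>2 - 1 - real m * (real m - 1) / 2"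
      by (simp add: power2_eq_square field_simps)
    ultimately show ?thesis
      unfolding D_def[symmetric] using True by linarith
  next
    case False
    then have mn: "m \<le> n" "n \<ge> 2" using m by auto
    define g where "g j = f (Suc j)" for j
    define F where "F j = q_block q {..<n} (g j)" for j
    define G where "G j = q_block q {m - 1..<n} (g j)" for j
    have g0: "g j \<noteq> 0" if "j \<le> m" for j
      using nonconst[of "Suc j"] that by (auto simp: g_def)
    have polyF: "poly (F j) z = q_shift_prod q n (f (Suc j)) z" for j z
      by (simp add: F_def g_def poly_q_block)
    have shift: "(\<Sum>i=1..m. h i) = (\<Sum>j<m. h (Suc j))" for h :: "nat \<Rightarrow> complex"
      by (rule sum.reindex_bij_witness[of _ Suc "\<lambda>i. i - 1"]) auto
    have "(\<Sum>i<m. i) + (\<Sum>j\<le>m. degree (G j)) + degree (F (u' - 1)) \<le> (\<Sum>j\<le>m. degree (F j))"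
    proof (rule degree_balance[OF q(1) inj_power_if_norm_neq_1[OF q]])
      show "m > 0" "u' - 1 \<le> m"
        using m u' by auto
      show "(\<Sum>j<m. F j) = F m"
      proof (rule poly_eq_poly_eq_iff[THEN iffD1], rule ext)
        show "poly (\<Sum>j<m. F j) z = poly (F m) z" for z
          using eq[of z] by (simp only: poly_sum polyF shift Suc_eq_plus1)
      qed
      show "a j = 0" if "(\<Sum>j<m. smult (a j) (F j)) = 0" "j < m" for a j
      proof -
        have "poly (\<Sum>j<m. smult (a j) (F j)) z = 0" for z
          using that by simp
        then have "(\<Sum>i=1..m. a (i - 1) * q_shift_prod q n (f i) z) = 0" for z
          by (simp only: shift diff_Suc_1) (simp add: poly_sum polyF)
        from indep[of "\<lambda>i. a (i - 1)", OF this, of "Suc j"] that show ?thesis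
          by simp
      qed
      show "monom 1 i * G j dvd qdiff q i (F j)" if "i < m" "j \<le> m" for i j
        unfolding F_def G_def
        using q(1) g0[OF that(2)] that(1) mn(1) by (rule monom_mult_q_block_dvd_qdiff)
      show "G j \<noteq> 0" if "j \<le> m" for j
        using g0[OF that] q by (simp add: G_def q_block_nonzero)
      show "coprime (G j) (G m)" if "j < m" for j
      proof (rule coprime_if_no_common_root)
        have G_dvd: "G l dvd F l" for l
          unfolding F_def G_def q_block_def by (rule prod_dvd_prod_subset) auto
        fix x assume "poly (G j) x = 0"
        then have "q_shift_prod q n (f (Suc j)) x = 0"
          using G_dvd[of j] by (auto simp flip: polyF)
        then have "q_shift_prod q n (f (Suc m)) x \<noteq> 0"
          using q mn that pairwiseD[OF qprime, of "Suc j" "Suc m"]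
            pairwiseD[OF qprime, of "Suc m" "Suc j"]
          by (intro relatively_q_prime_no_common_zero[of q n "f (Suc j)"]) auto
        then show "poly (G m) x \<noteq> 0"
          using G_dvd[of m] by (auto simp flip: polyF)
      qed
    qed
    moreover define S where "S = (\<Sum>j\<le>m. degree (g j))"
    moreover have "(\<Sum>j\<le>m. degree (G j)) = (n - (m - 1)) * S"
      using q g0 by (simp add: G_def S_def degree_q_block sum_distrib_left)
    moreover have "(\<Sum>j\<le>m. degree (F j)) = n * S"
      using q g0 by (simp add: F_def S_def degree_q_block sum_distrib_left)
    moreover have "degree (F (u' - 1)) = n * D"
      using q g0[of "u' - 1"] u' by (auto simp: F_def degree_q_block g_def)
    ultimately have "(\<Sum>i<m. i) + (n - (m - 1)) * S + n * D \<le> n * S"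
      by simp
    then have "(\<Sum>i<m. i) + (n - (m - 1)) * S + n * D \<le> (n - (m - 1)) * S + (m - 1) * S"
      using mn(1) by (simp flip: distrib_right)
    then have "(\<Sum>i<m. i) + n * D \<le> (m - 1) * S"
      by simp
    also have "S \<le> (m + 1) * D"
      using sum_bounded_above[of "{..m}" "\<lambda>j. degree (g j)" D] D_ge by (simp add: S_def g_def)
    finally have "(\<Sum>i<m. i) + n * D \<le> (m - 1) * ((m + 1) * D)"
      by simp
    then have "real ((\<Sum>i<m. i) + n * D) \<le> real ((m - 1) * ((m + 1) * D))"
      by (simp only: of_nat_le_iff)
    then have "real (\<Sum>i<m. i) + real n * real D \<le> real (m - 1) * (real (m + 1) * real D)"
      by (simp only: of_nat_add of_nat_mult)
    then have "real (\<Sum>i<m. i) + real n * real D \<le> (real m - 1) * ((real m + 1) * real D)"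
      using m by (simp add: of_nat_diff add.commute)
    moreover have "real (\<Sum>i<k. i) = real k * (real k - 1) / 2" for k
      by (induction k) (simp_all add: field_simps del: of_nat_sum)
    ultimately have "real n * real D + real m * (real m - 1) / 2 \<le> ((real m)\<^sup>2 - 1) * real D"
      by (simp add: power2_eq_square algebra_simps del: of_nat_sum)
    then show ?thesis
      unfolding D_def[symmetric] using \<open>D \<ge> 1\<close> by (simp add: field_simps)
  qed
qed

end
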